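(* Let $q\ge 7$ be an integer not divisible by $3$ (that is, $q=7,8,10,11,\dots$), and let $r_0=\lfloor q/3\rfloor$ be the integer part of $q/3$. Then $$A(3/q)=\frac{1}{q}\left(1+\frac{1-2\bigl(\cos(2\pi r_0/q)+\cos(2\pi(r_0+1)/q)\bigr)}{1+2\cos(2\pi r_0/q)\cos(2\pi(r_0+1)/q)}\right).$$
   Context: For $0<h\le 1/2$, $K(h)$ denotes the class of continuous $1$-periodic even functions $f:\mathbb{R}\to\mathbb{R}$ such that: (1) $f(x)=\sum_{n=0}^{\infty}a_n\cos(2\pi nx)$; (2) $a_n\ge 0$ for all $n=0,1,2,\dots$; (3) $f(0)=\sum_{n=0}^{\infty}a_n=1$; (4) $f(x)=0$ for $h\le |x|\le 1/2$. Define $A(h)=\sup_{f\in K(h)}a_0=\sup_{f\in K(h)}\int_{-h}^{h}f(x)\,dx$. *)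

theory Defs
  imports "HOL-Analysis.Analysis"
begin

definition nonneg_cosine_expansion :: "(real \<Rightarrow> real) \<Rightarrow> (nat \<Rightarrow> real) \<Rightarrow> bool" where
  "nonneg_cosine_expansion f a \<longleftrightarrow>
     (\<forall>x. (\<lambda>n. a n * cos (2 * pi * real n * x)) sums f x) \<and>
     (\<forall>n. 0 \<le> a n) \<and>
     a sums 1"

definition K_class :: "real \<Rightarrow> (real \<Rightarrow> real) set" where
  "K_class h = {f. continuous_on UNIV f \<and>
     (\<forall>x. f (x + 1) = f x) \<and>
     (\<forall>x. f (- x) = f x) \<and>
     (\<exists>a. nonneg_cosine_expansion f a) \<and>
     f 0 = 1 \<and>
     (\<forall>x. h \<le> \<bar>x\<bar> \<and> \<bar>x\<bar> \<le> 1 / 2 \<longrightarrow> f x = 0)}"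

text \<open>The expansion of a given \<open>f\<close> is unique; its constant term is the integral of \<open>f\<close>
  (lemma \<open>constant_term_eq_integral\<close> below). For \<open>0 < h \<le> 1/2\<close> the set under the supremum is
  non-empty (it contains the constant term of the triangle function on \<open>[-h, h]\<close>)
  and bounded above by 1.\<close>

definition A_sup :: "real \<Rightarrow> real" where
  "A_sup h = Sup {a 0 | f a. f \<in> K_class h \<and> nonneg_cosine_expansion f a}"

lemma integral_cos_period:
  fixes n :: nat
  shows "((\<lambda>x. cos (2 * pi * real n * x)) has_integral (if n = 0 then 1 else 0)) {-1/2..1/2::real}"
proof (cases "n = 0")
  case True
  then show ?thesis using has_integral_const_real[of "1::real" "-1/2" "1/2"] by simp
next
  case False
  define F where "F = (\<lambda>x. sin (2 * pi * real n * x) / (2 * pi * real n))"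
  have "((\<lambda>x. cos (2 * pi * real n * x)) has_integral (F (1/2) - F (-1/2))) {-1/2..1/2::real}"
    unfolding F_def
  proof (rule fundamental_theorem_of_calculus)
    fix x :: real
    show "((\<lambda>x. sin (2 * pi * real n * x) / (2 * pi * real n)) has_vector_derivative
            cos (2 * pi * real n * x)) (at x within {-1/2..1/2})"
      unfolding has_real_derivative_iff_has_vector_derivative[symmetric]
      using False by (auto intro!: derivative_eq_intros simp: field_simps)
  qed simp
  moreover have "sin (pi * real n) = 0" by (simp add: mult.commute)
  ultimately show ?thesis using False by (simp add: F_def)
qed

lemma constant_term_eq_integral:
  assumes h: "0 < h" "h \<le> 1 / 2" and f: "f \<in> K_class h" and a: "nonneg_cosine_expansion f a"
  shows "a 0 = integral {-h..h} f"
proof -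
  let ?g = "\<lambda>n x. a n * cos (2 * pi * real n * x)"
  let ?S = "{-1/2..1/2::real}"
  have nonneg: "0 \<le> a n" for n using a by (simp add: nonneg_cosine_expansion_def)
  have f_sums: "(\<Sum>n. ?g n x) = f x" for x
    using a by (simp add: nonneg_cosine_expansion_def sums_unique[symmetric])
  have "summable a" using a by (auto simp: nonneg_cosine_expansion_def sums_iff)
  then have "uniform_limit ?S (\<lambda>N x. \<Sum>n<N. ?g n x) (\<lambda>x. \<Sum>n. ?g n x) sequentially"
    using nonneg by (intro Weierstrass_m_test[where M = a])
      (auto simp: abs_mult intro!: mult_left_le)
  then have lim: "uniform_limit ?S (\<lambda>N x. \<Sum>n<N. ?g n x) f sequentially"
    by (simp add: f_sums)
  have part: "((\<lambda>x. \<Sum>n<N. ?g n x) has_integral (\<Sum>n<N. a n * (if n = 0 then 1 else 0))) ?S" for N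
    by (intro has_integral_sum has_integral_mult_right integral_cos_period) auto
  have cont: "continuous_on ?S (\<lambda>x. \<Sum>n<N. ?g n x)" for N
    by (intro continuous_intros)
  obtain I J where I: "\<And>N. ((\<lambda>x. \<Sum>n<N. ?g n x) has_integral I N) ?S"
    and J: "(f has_integral J) ?S" and IJ: "I \<longlonglongrightarrow> J"
    using uniform_limit_integral[OF lim cont trivial_limit_sequentially] by blast
  have "I N = (if N = 0 then 0 else a 0)" for N
  proof -
    have "I N = (\<Sum>n<N. a n * (if n = 0 then 1 else 0))"
      using has_integral_unique[OF I part] .
    also have "\<dots> = (\<Sum>n<N. if n = 0 then a n else 0)" by (intro sum.cong) auto
    also have "\<dots> = (if N = 0 then 0 else a 0)" by (simp add: sum.delta)
    finally show ?thesis .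
  qed
  then have "\<forall>\<^sub>F N in sequentially. I N = a 0"
    by (intro eventually_sequentiallyI[of 1]) simp
  then have "I \<longlonglongrightarrow> a 0" by (rule tendsto_eventually)
  then have Ja: "J = a 0" using IJ LIMSEQ_unique by blast
  have zero: "f x = 0" if "h \<le> \<bar>x\<bar>" "\<bar>x\<bar> \<le> 1 / 2" for x
    using f that by (auto simp: K_class_def)
  have "f x = 0" if "x \<in> ?S - {-h..h}" for x
    using that by (intro zero) (auto simp: abs_if)
  then have "{x \<in> {-h..h} - ?S. f x \<noteq> 0} = {}" "{x \<in> ?S - {-h..h}. f x \<noteq> 0} = {}"
    using h by auto
  then have "integral {-h..h} f = integral ?S f"
    by (intro integral_spike_set) (simp_all only: negligible_empty)
  with J Ja show ?thesis by (simp add: integral_unique)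
qed

lemma A_sup_eq_integral:
  assumes h: "0 < h" "h \<le> 1 / 2"
  shows "A_sup h = (SUP f\<in>K_class h. integral {-h..h} f)"
proof -
  have "{a 0 | f a. f \<in> K_class h \<and> nonneg_cosine_expansion f a} =
        (\<lambda>f. integral {-h..h} f) ` K_class h" (is "?L = ?R")
  proof
    show "?L \<subseteq> ?R" using constant_term_eq_integral[OF h] by auto
    show "?R \<subseteq> ?L"
    proof
      fix y assume "y \<in> ?R"
      then obtain f where f: "f \<in> K_class h" and y: "y = integral {-h..h} f" by auto
      obtain a where a: "nonneg_cosine_expansion f a" using f by (auto simp: K_class_def)
      have "y = a 0" using constant_term_eq_integral[OF h f a] y by simp
      then show "y \<in> ?L" using f a by blast
    qed
  qed
  then show ?thesis by (simp add: A_sup_def)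
qed

end

theory Submission
  imports Defs
begin

text \<open>
  Sampling an admissible \<open>f\<close> at the points \<open>k/q\<close> turns the extremal problem for
  \<open>h = 3/q\<close> into a linear program in the two numbers \<open>u = f (1/q)\<close> and
  \<open>v = f (2/q)\<close>, because all other samples vanish up to symmetry.

  For the upper bound, the discrete cosine transform of the samples at frequency \<open>r\<close> is
  \<open>P r = 1 + 2 u cos (2 \<pi> r / q) + 2 v cos (4 \<pi> r / q)\<close>. It collects, with positive factors,
  those coefficients \<open>a n\<close> whose index \<open>n\<close> is congruent to \<open>r\<close> or \<open>- r\<close> modulo \<open>q\<close>, so
  it is nonnegative, and at \<open>r = 0\<close> it is at least \<open>q * a 0\<close>. Hence \<open>q * a 0\<close> is at most
  the largest value of \<open>1 + 2 u + 2 v\<close> subject to \<open>P r \<ge> 0\<close> for all \<open>r\<close>. The two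
  constraints at \<open>r\<^sub>0\<close> and \<open>r\<^sub>0 + 1\<close> already bound this value: a combination of them with
  positive weights cancels \<open>u\<close> and \<open>v\<close>
  (\<open>two_node_linear_programming_bound\<close>). The weights are positive because \<open>r\<^sub>0/q\<close> and
  \<open>(r\<^sub>0 + 1)/q\<close> lie on the two sides of \<open>1/3\<close>, where the cosine of \<open>2 \<pi> x\<close> equals \<open>- 1/2\<close>.

  Equality forces \<open>P\<close>, a quadratic polynomial in the cosine, to vanish at both nodes, which determines
  \<open>u\<close> and \<open>v\<close>. Then \<open>P r \<ge> 0\<close> holds for every integer \<open>r\<close> because no node
  \<open>cos (2 \<pi> r / q)\<close> lies strictly between two adjacent ones
  (\<open>cos_between_adjacent_nodes\<close>). The extremal function is the piecewise linear interpolant of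
  the samples: its Fourier coefficients are those of the triangle function of half-width \<open>1/q\<close>,
  which are nonnegative, multiplied by \<open>P\<close>
  (\<open>interpolant_of_positive_samples\<close>). Interpolation does not enlarge the constant term beyond
  the sample mean, as the coefficients of that triangle function vanish at all nonzero
  multiples of \<open>q\<close>.

  What remains is that the triangle function is the sum of its Fourier series. It is a second
  difference of the series of \<open>cos (2 \<pi> n x) / n\<^sup>2\<close>, whose sum is quadratic on \<open>[0, 1]\<close>
  (\<open>cos_square_series_eq\<close>).
\<close>

section \<open>The series of \<open>cos (2 \<pi> n x) / n\<^sup>2\<close>\<close>

lemma dirichlet_kernel_closed_form:
  fixes x :: real
  shows "2 * sin (x / 2) * (\<Sum>n<N. cos (real n * x)) = sin ((real N - 1/2) * x) + sin (x / 2)"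
proof (induction N)
  case 0
  then show ?case by (simp add: left_diff_distrib)
next
  case (Suc N)
  have "2 * sin (x / 2) * cos (real N * x) = sin ((real N + 1/2) * x) - sin ((real N - 1/2) * x)"
    by (simp add: distrib_right left_diff_distrib sin_add sin_diff)
  with Suc show ?case by (simp add: distrib_left algebra_simps)
qed

text \<open>The derivative of the error is half a Dirichlet kernel, which does not tend to zero but
  oscillates. Adding the small term
  \<open>cos ((N + 1/2) x) / ((2 N + 1) sin (x / 2))\<close>, whose derivative cancels the kernel up to
  order \<open>1 / N\<close>, leaves a function \<open>E\<close> whose derivative is of order \<open>1 / N\<close> away from the
  multiples of \<open>2 \<pi>\<close>. Since \<open>E\<close> vanishes at \<open>\<pi>\<close>, it is of that order itself.\<close>

lemma sawtooth_partial_sum_error: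
  fixes x \<delta> :: real
  assumes "0 < \<delta>" "\<delta> \<le> x" "x \<le> 2 * pi - \<delta>"
  shows "\<bar>(\<Sum>n<Suc N. sin (real n * x) / real n) - (pi - x) / 2\<bar>
           \<le> (pi / (2 * (sin (\<delta> / 2))\<^sup>2) + 1 / sin (\<delta> / 2)) / (2 * real N + 1)"
proof -
  define M where "M = 2 * real N + 1"
  define s where "s = sin (\<delta> / 2)"
  define E where "E y = (\<Sum>n<Suc N. sin (real n * y) / real n) - (pi - y) / 2
                          + cos (M / 2 * y) / (M * sin (y / 2))" for y
  define E' where "E' y = - (cos (M / 2 * y) * cos (y / 2)) / (2 * M * (sin (y / 2))\<^sup>2)" for y
  have M: "M > 0" by (simp add: M_def)
  have s: "s > 0" unfolding s_def using assms by (intro sin_gt_zero) auto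
  have sin_ge: "s \<le> sin (y / 2)" if "y \<in> {\<delta>..2 * pi - \<delta>}" for y
  proof (cases "y \<le> pi")
    case True
    then show ?thesis unfolding s_def using that assms by (intro sin_monotone_2pi_le) auto
  next
    case False
    then have "s \<le> sin (pi - y / 2)"
      unfolding s_def using that assms by (intro sin_monotone_2pi_le) auto
    then show ?thesis by simp
  qed
  have deriv: "(E has_real_derivative E' y) (at y within {\<delta>..2 * pi - \<delta>})"
    if y: "y \<in> {\<delta>..2 * pi - \<delta>}" for y
  proof -
    have pos: "sin (y / 2) > 0" using sin_ge[OF y] s by linarith
    have deriv_term: "((\<lambda>y. sin (real n * y) / real n) has_real_derivative
                   cos (real n * y) - (if n = 0 then 1 else 0)) (at y within {\<delta>..2 * pi - \<delta>})" for n
      by (cases "n = 0") (auto intro!: derivative_eq_intros)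
    have "(\<Sum>n<Suc N. cos (real n * y) - (if n = 0 then 1 else 0))
            = (\<Sum>n<Suc N. cos (real n * y)) - 1"
      by (simp add: sum_subtractf sum.delta del: sum.lessThan_Suc)
    also have "(\<Sum>n<Suc N. cos (real n * y)) = sin (M / 2 * y) / (2 * sin (y / 2)) + 1 / 2"
      using dirichlet_kernel_closed_form[of y "Suc N"] pos
      by (simp add: field_simps M_def del: sum.lessThan_Suc)
    finally have sum: "(\<Sum>n<Suc N. cos (real n * y) - (if n = 0 then 1 else 0))
            = sin (M / 2 * y) / (2 * sin (y / 2)) - 1 / 2" by simp
    have "((\<lambda>y. \<Sum>n<Suc N. sin (real n * y) / real n) has_real_derivative
             sin (M / 2 * y) / (2 * sin (y / 2)) - 1 / 2) (at y within {\<delta>..2 * pi - \<delta>})"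
      unfolding sum[symmetric] by (intro DERIV_sum deriv_term)
    moreover have "((\<lambda>y. (pi - y) / 2) has_real_derivative - 1 / 2) (at y within {\<delta>..2 * pi - \<delta>})"
      by (auto intro!: derivative_eq_intros)
    moreover have "((\<lambda>y. cos (M / 2 * y) / (M * sin (y / 2))) has_real_derivative
        E' y - sin (M / 2 * y) / (2 * sin (y / 2))) (at y within {\<delta>..2 * pi - \<delta>})"
    proof (rule DERIV_cong)
      show "((\<lambda>y. cos (M / 2 * y) / (M * sin (y / 2))) has_real_derivative
          (- (sin (M / 2 * y) * (M / 2)) * (M * sin (y / 2)) - cos (M / 2 * y) * (M * (cos (y / 2) * (1 / 2))))
            / ((M * sin (y / 2)) * (M * sin (y / 2)))) (at y within {\<delta>..2 * pi - \<delta>})"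
        using pos M by (auto intro!: derivative_eq_intros)
    qed (use pos M in \<open>simp add: E'_def field_simps power2_eq_square\<close>)
    ultimately show ?thesis
      unfolding E_def by (rule DERIV_cong[OF DERIV_add[OF DERIV_diff]]) simp
  qed
  have E'_bound: "norm (E' y) \<le> 1 / (2 * M * s\<^sup>2)" if y: "y \<in> {\<delta>..2 * pi - \<delta>}" for y
  proof -
    have "\<bar>cos (M / 2 * y) * cos (y / 2)\<bar> \<le> 1"
      unfolding abs_mult by (intro mult_le_one) auto
    moreover have "2 * M * s\<^sup>2 \<le> 2 * M * (sin (y / 2))\<^sup>2"
      using sin_ge[OF y] s M by (intro mult_left_mono power_mono) auto
    moreover have "0 < 2 * M * s\<^sup>2" using M s by simp
    ultimately show ?thesis unfolding E'_def using M
      by (simp add: abs_divide abs_mult frac_le)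
  qed
  have "sin (real n * pi) / real n = 0" for n by simp
  moreover have "cos (M / 2 * pi) = 0"
    by (simp add: M_def add_divide_distrib distrib_right cos_add)
  ultimately have E_pi: "E pi = 0" by (simp add: E_def)
  have "norm (E x - E pi) \<le> 1 / (2 * M * s\<^sup>2) * norm (x - pi)"
    using assms by (intro field_differentiable_bound[OF _ deriv E'_bound]) auto
  also have "\<dots> \<le> 1 / (2 * M * s\<^sup>2) * pi"
    using assms M by (intro mult_left_mono) (auto simp: abs_if)
  finally have E_x: "\<bar>E x\<bar> \<le> pi / (2 * M * s\<^sup>2)" by (simp add: E_pi)
  have "M * s \<le> M * sin (x / 2)" using sin_ge[of x] assms M by (intro mult_left_mono) auto
  moreover have "0 < M * s" using M s by simp
  moreover have "\<bar>cos (M / 2 * x)\<bar> \<le> 1" by simp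
  ultimately have "\<bar>cos (M / 2 * x)\<bar> / \<bar>M * sin (x / 2)\<bar> \<le> 1 / (M * s)"
    by (intro frac_le) auto
  then have "\<bar>cos (M / 2 * x) / (M * sin (x / 2))\<bar> \<le> 1 / (M * s)"
    by (simp only: abs_divide)
  with E_x have "\<bar>(\<Sum>n<Suc N. sin (real n * x) / real n) - (pi - x) / 2\<bar>
      \<le> pi / (2 * M * s\<^sup>2) + 1 / (M * s)"
    unfolding E_def by linarith
  also have "\<dots> = (pi / (2 * s\<^sup>2) + 1 / s) / M" by (simp add: add_divide_distrib mult_ac)
  finally show ?thesis unfolding s_def M_def .
qed

lemma sawtooth_uniform_limit:
  fixes \<delta> :: real
  assumes "0 < \<delta>"
  shows "uniform_limit {\<delta>..2 * pi - \<delta>} (\<lambda>N x. \<Sum>n<N. sin (real n * x) / real n)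
           (\<lambda>x. (pi - x) / 2) sequentially"
proof -
  define C where "C = pi / (2 * (sin (\<delta> / 2))\<^sup>2) + 1 / sin (\<delta> / 2)"
  have "filterlim (\<lambda>N. 2 * real N + 1) at_top sequentially"
    by (rule filterlim_at_top_mono[OF filterlim_real_sequentially]) auto
  then have lim: "(\<lambda>N. C / (2 * real N + 1)) \<longlonglongrightarrow> 0"
    by (rule real_tendsto_divide_at_top[OF tendsto_const])
  have "uniform_limit {\<delta>..2 * pi - \<delta>} (\<lambda>N x. \<Sum>n<Suc N. sin (real n * x) / real n)
           (\<lambda>x. (pi - x) / 2) sequentially"
    unfolding uniform_limit_iff
  proof (intro allI impI)
    fix e :: real assume "0 < e"
    with lim have "\<forall>\<^sub>F N in sequentially. C / (2 * real N + 1) < e"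
      by (rule order_tendstoD)
    then show "\<forall>\<^sub>F N in sequentially. \<forall>x\<in>{\<delta>..2 * pi - \<delta>}.
        dist (\<Sum>n<Suc N. sin (real n * x) / real n) ((pi - x) / 2) < e"
    proof eventually_elim
      case (elim N)
      show ?case
      proof
        fix x assume "x \<in> {\<delta>..2 * pi - \<delta>}"
        then have "dist (\<Sum>n<Suc N. sin (real n * x) / real n) ((pi - x) / 2) \<le> C / (2 * real N + 1)"
          unfolding dist_real_def C_def by (intro sawtooth_partial_sum_error[OF assms]) auto
        also note elim
        finally show "dist (\<Sum>n<Suc N. sin (real n * x) / real n) ((pi - x) / 2) < e" .
      qed
    qed
  qed
  then show ?thesis
    by (rule filterlim_sequentially_Suc[THEN iffD1])
qed

text \<open>The term at index zero is \<open>1 / 0 = 0\<close>, so the sum starts at \<open>n = 1\<close> in effect. This is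
  \<open>\<pi>\<^sup>2\<close> times the periodic extension of the second Bernoulli polynomial.\<close>

definition cos_square_series :: "real \<Rightarrow> real" where
  "cos_square_series x = (\<Sum>n. cos (2 * pi * real n * x) / (real n)\<^sup>2)"

lemma summable_cos_square:
  fixes t :: "nat \<Rightarrow> real"
  shows "summable (\<lambda>n. cos (t n) / (real n)\<^sup>2)"
proof (rule summable_comparison_test)
  show "\<exists>N. \<forall>n\<ge>N. norm (cos (t n) / (real n)\<^sup>2) \<le> inverse (real n ^ 2)"
    by (auto simp: divide_inverse abs_mult intro!: mult_left_le_one_le)
  show "summable (\<lambda>n. inverse (real n ^ 2))" by (rule inverse_power_summable) simp
qed

lemma cos_square_series_sums:
  "(\<lambda>n. cos (2 * pi * real n * x) / (real n)\<^sup>2) sums cos_square_series x"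
  unfolding cos_square_series_def by (intro summable_sums summable_cos_square)

lemma cos_square_series_minus [simp]: "cos_square_series (- x) = cos_square_series x"
  by (simp add: cos_square_series_def)

lemma continuous_on_cos_square_series: "continuous_on A cos_square_series"
proof (rule uniform_limit_theorem)
  show "uniform_limit A (\<lambda>N x. \<Sum>n<N. cos (2 * pi * real n * x) / (real n)\<^sup>2)
          cos_square_series sequentially"
    unfolding cos_square_series_def
  proof (rule Weierstrass_m_test)
    show "summable (\<lambda>n. inverse (real n ^ 2))" by (rule inverse_power_summable) simp
    show "norm (cos (2 * pi * real n * x) / (real n)\<^sup>2) \<le> inverse (real n ^ 2)" for n x
      by (auto simp: divide_inverse abs_mult intro!: mult_left_le_one_le)
  qed
next
  have "continuous_on A (\<lambda>x. cos (2 * pi * real n * x) / (real n)\<^sup>2)" for n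
    by (cases "n = 0") (auto intro!: continuous_intros)
  then show "\<forall>\<^sub>F N in sequentially. continuous_on A (\<lambda>x. \<Sum>n<N. cos (2 * pi * real n * x) / (real n)\<^sup>2)"
    by (intro always_eventually allI continuous_on_sum)
qed simp

text \<open>Termwise differentiation gives a sawtooth series. It converges uniformly only away from the
  integers, hence the restriction to an interval \<open>[\<delta>, 1 - \<delta>]\<close> around the point.\<close>

lemma cos_square_series_deriv:
  assumes "0 < x" "x < 1"
  shows "(cos_square_series has_real_derivative pi\<^sup>2 * (2 * x - 1)) (at x)"
proof -
  define \<delta> where "\<delta> = min x (1 - x) / 2"
  have \<delta>: "0 < \<delta>" "\<delta> < x" "x < 1 - \<delta>" using assms by (auto simp: \<delta>_def min_def field_simps)
  let ?S = "{\<delta>..1 - \<delta>}"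
  have range: "2 * pi * y \<in> {2 * pi * \<delta>..2 * pi - 2 * pi * \<delta>}" if "y \<in> ?S" for y
    using that mult_left_mono[of \<delta> y "2 * pi"] mult_left_mono[of y "1 - \<delta>" "2 * pi"]
    by (auto simp: right_diff_distrib)
  have saw: "uniform_limit ?S (\<lambda>N x. \<Sum>n<N. sin (real n * (2 * pi * x)) / real n)
          (\<lambda>x. (pi - 2 * pi * x) / 2) sequentially"
    using \<delta> by (intro uniform_limit_compose'[OF sawtooth_uniform_limit[of "2 * pi * \<delta>"]])
      (use range in auto)
  have "uniform_limit ?S
          (\<lambda>N x. (- 2 * pi) * (\<Sum>n<N. sin (real n * (2 * pi * x)) / real n))
          (\<lambda>x. (- 2 * pi) * ((pi - 2 * pi * x) / 2)) sequentially"
    by (intro bounded_linear_uniform_limit_intros saw)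
  moreover have "(- 2 * pi) * ((pi - 2 * pi * x) / 2) = pi\<^sup>2 * (2 * x - 1)" for x
    by (simp add: field_simps power2_eq_square)
  ultimately have lim: "uniform_limit ?S
          (\<lambda>N x. \<Sum>n<N. (- 2 * pi) * (sin (real n * (2 * pi * x)) / real n))
          (\<lambda>x. pi\<^sup>2 * (2 * x - 1)) sequentially"
    by (simp only: sum_distrib_left)
  have deriv_term: "((\<lambda>x. cos (2 * pi * real n * x) / (real n)\<^sup>2) has_real_derivative
          (- 2 * pi) * (sin (real n * (2 * pi * x)) / real n)) (at x within ?S)" for n x
    by (cases "n = 0")
      (auto intro!: derivative_eq_intros simp: power2_eq_square mult_ac)
  have "\<exists>g. \<forall>y\<in>?S. (\<lambda>n. cos (2 * pi * real n * y) / (real n)\<^sup>2) sums g y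
      \<and> (g has_real_derivative pi\<^sup>2 * (2 * y - 1)) (at y within ?S)"
    using \<delta> by (intro has_field_derivative_series[OF _ deriv_term lim, of x] summable_cos_square) auto
  then obtain g where g: "\<And>y. y \<in> ?S \<Longrightarrow> (\<lambda>n. cos (2 * pi * real n * y) / (real n)\<^sup>2) sums g y"
    and g': "\<And>y. y \<in> ?S \<Longrightarrow> (g has_real_derivative pi\<^sup>2 * (2 * y - 1)) (at y within ?S)"
    by blast
  have "cos_square_series y = g y" if "y \<in> ?S" for y
    using sums_unique2[OF cos_square_series_sums g[OF that]] .
  then have "(cos_square_series has_real_derivative pi\<^sup>2 * (2 * x - 1)) (at x within ?S)"
    using \<delta> by (intro has_field_derivative_transform_within[OF g', of _ 1]) auto
  moreover have "at x within ?S = at x"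
    using \<delta> by (intro at_within_interior) (simp add: interior_atLeastAtMost_real)
  ultimately show ?thesis by simp
qed

text \<open>The derivative is known on the open interval and continuity extends the identity to the
  end points. The constant \<open>cos_square_series 0\<close>, which is \<open>\<pi>\<^sup>2 / 6\<close>, may stay unevaluated: it
  cancels in second differences.\<close>

lemma cos_square_series_eq:
  assumes "0 \<le> x" "x \<le> 1"
  shows "cos_square_series x = pi\<^sup>2 * (x\<^sup>2 - x) + cos_square_series 0"
proof (cases "x = 0")
  case False
  let ?g = "\<lambda>y. cos_square_series y - pi\<^sup>2 * (y\<^sup>2 - y)"
  have "?g x = ?g 0"
  proof (rule DERIV_isconst_end[where f = ?g])
    show "0 < x" using False assms by simp
    show "continuous_on {0..x} ?g"
      by (intro continuous_intros continuous_on_cos_square_series)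
    show "(?g has_real_derivative 0) (at y)" if "0 < y" "y < x" for y
      using that assms
      by (auto intro!: derivative_eq_intros cos_square_series_deriv)
  qed
  then show ?thesis by simp
qed simp

section \<open>The triangle function\<close>

text \<open>The cosine coefficients of the \<open>1\<close>-periodic triangle function of height \<open>1\<close> and
  half-width \<open>w\<close>: the coefficient at \<open>n > 0\<close> is
  \<open>2 w (sin (\<pi> n w) / (\<pi> n w))\<^sup>2\<close>.\<close>

definition hat_coeff :: "real \<Rightarrow> nat \<Rightarrow> real" where
  "hat_coeff w n = (if n = 0 then w else (1 - cos (2 * pi * real n * w)) / (pi\<^sup>2 * w * (real n)\<^sup>2))"

text \<open>The triangle function written as a second difference, so that its cosine series is
  that of \<open>cos_square_series\<close> with multiplied coefficients.\<close>

definition hat :: "real \<Rightarrow> real \<Rightarrow> real" where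
  "hat w x = w + (cos_square_series x - (cos_square_series (x + w) + cos_square_series (x - w)) / 2)
                   / (pi\<^sup>2 * w)"

lemma hat_coeff_nonneg: "0 \<le> w \<Longrightarrow> 0 \<le> hat_coeff w n"
  by (simp add: hat_coeff_def)

lemma hat_sums: "(\<lambda>n. hat_coeff w n * cos (2 * pi * real n * x)) sums hat w x"
proof -
  let ?c = "\<lambda>x n. cos (2 * pi * real n * x) / (real n)\<^sup>2"
  have "(\<lambda>n. if n = 0 then w else 0) sums w"
    using sums_single[of 0 "\<lambda>_. w"] by simp
  then have "(\<lambda>n. (if n = 0 then w else 0) + (?c x n - (?c (x + w) n + ?c (x - w) n) / 2) / (pi\<^sup>2 * w))
          sums hat w x"
    unfolding hat_def
    by (intro sums_add sums_divide sums_diff cos_square_series_sums)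
  moreover have "(if n = 0 then w else 0) + (?c x n - (?c (x + w) n + ?c (x - w) n) / 2) / (pi\<^sup>2 * w)
      = hat_coeff w n * cos (2 * pi * real n * x)" for n
  proof -
    have "cos (2 * pi * real n * (x + w)) + cos (2 * pi * real n * (x - w))
        = 2 * (cos (2 * pi * real n * x) * cos (2 * pi * real n * w))"
      unfolding distrib_left right_diff_distrib cos_add cos_diff by simp
    then have "(?c (x + w) n + ?c (x - w) n) / 2
        = cos (2 * pi * real n * x) * cos (2 * pi * real n * w) / (real n)\<^sup>2"
      by (simp only: add_divide_distrib[symmetric]) simp
    then show ?thesis
      by (simp add: hat_coeff_def diff_divide_distrib[symmetric] right_diff_distrib left_diff_distrib mult_ac)
  qed
  ultimately show ?thesis by simp
qed

lemma hat_minus: "hat w (- x) = hat w x"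
proof -
  have "cos_square_series (- x + w) = cos_square_series (x - w)"
    "cos_square_series (- x - w) = cos_square_series (x + w)"
    using cos_square_series_minus[of "x - w"] cos_square_series_minus[of "x + w"] by simp_all
  then show ?thesis by (simp add: hat_def)
qed

lemma hat_0:
  assumes "0 < w" "w \<le> 1"
  shows "hat w 0 = 1"
proof -
  have "cos_square_series 0 - (cos_square_series (0 + w) + cos_square_series (0 - w)) / 2
          = (1 - w) * (pi\<^sup>2 * w)"
    using assms cos_square_series_eq[of w] by (simp add: algebra_simps power2_eq_square)
  then show ?thesis using assms by (simp only: hat_def) simp
qed

text \<open>The three arguments \<open>x\<close>, \<open>x + w\<close>, \<open>x - w\<close> stay in \<open>[0, 1]\<close>, where the series
  is a quadratic polynomial and its second difference is constant. The constant term \<open>w\<close>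
  compensates exactly this constant.\<close>

lemma hat_eq_0:
  assumes "0 < w" "w \<le> x" "x \<le> 1 - w"
  shows "hat w x = 0"
proof -
  have eqs: "cos_square_series x = pi\<^sup>2 * (x\<^sup>2 - x) + cos_square_series 0"
    "cos_square_series (x + w) = pi\<^sup>2 * ((x + w)\<^sup>2 - (x + w)) + cos_square_series 0"
    "cos_square_series (x - w) = pi\<^sup>2 * ((x - w)\<^sup>2 - (x - w)) + cos_square_series 0"
    by (rule cos_square_series_eq; use assms in linarith)+
  have "cos_square_series x - (cos_square_series (x + w) + cos_square_series (x - w)) / 2
          = - w * (pi\<^sup>2 * w)"
    unfolding eqs by (simp add: algebra_simps power2_eq_square add_divide_distrib diff_divide_distrib)
  then show ?thesis using assms by (simp only: hat_def) simp
qed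

section \<open>Admissible functions\<close>

lemma nonneg_cosine_expansion_continuous:
  assumes "nonneg_cosine_expansion f a"
  shows "continuous_on A f"
proof (rule uniform_limit_theorem)
  have "f = (\<lambda>x. \<Sum>n. a n * cos (2 * pi * real n * x))"
    using assms by (auto simp: nonneg_cosine_expansion_def sums_iff)
  moreover have "uniform_limit A (\<lambda>N x. \<Sum>n<N. a n * cos (2 * pi * real n * x))
      (\<lambda>x. \<Sum>n. a n * cos (2 * pi * real n * x)) sequentially"
    using assms by (intro Weierstrass_m_test[where M = a])
      (auto simp: nonneg_cosine_expansion_def sums_iff abs_mult intro!: mult_left_le)
  ultimately show "uniform_limit A (\<lambda>N x. \<Sum>n<N. a n * cos (2 * pi * real n * x)) f sequentially"
    by simp
qed (auto intro!: always_eventually continuous_intros)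

text \<open>Continuity, periodicity, evenness and the value at \<open>0\<close> are inherited from the series, so
  vanishing on \<open>[h, 1/2]\<close> is all that needs a check.\<close>

lemma nonneg_cosine_expansion_in_K_class:
  assumes a: "nonneg_cosine_expansion f a"
    and zero: "\<And>x. h \<le> x \<Longrightarrow> x \<le> 1 / 2 \<Longrightarrow> f x = 0"
  shows "f \<in> K_class h"
proof -
  have sums: "(\<lambda>n. a n * cos (2 * pi * real n * x)) sums f x" for x
    using a by (simp add: nonneg_cosine_expansion_def)
  have "cos (2 * pi * real n * (x + 1)) = cos (2 * pi * real n * x)" for n x
  proof -
    have "sin (2 * pi * real n) = 0" "cos (2 * pi * real n) = 1"
      using sin_2npi[of n] cos_2npi[of n] by (simp_all add: mult_ac)
    then show ?thesis by (simp add: distrib_left cos_add)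
  qed
  then have period: "f (x + 1) = f x" for x
    using sums_unique2[OF sums[of x]] sums[of "x + 1"] by simp
  have even: "f (- x) = f x" for x
    using sums_unique2[OF sums[of x]] sums[of "- x"] by simp
  have "f 0 = 1"
    using sums_unique2[of a "f 0" 1] sums[of 0] a by (simp add: nonneg_cosine_expansion_def)
  moreover have "f x = 0" if "h \<le> \<bar>x\<bar>" "\<bar>x\<bar> \<le> 1 / 2" for x
    using zero[OF that] even[of x] by (auto simp: abs_if split: if_splits)
  ultimately show ?thesis
    using period even a nonneg_cosine_expansion_continuous[OF a] by (auto simp: K_class_def)
qed

section \<open>The upper bound\<close>

text \<open>The sum over all \<open>q\<close>-th roots of unity of a fixed power is \<open>q\<close> or \<open>0\<close>.\<close>

lemma sum_cos_roots_of_unity_nonneg: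
  fixes m :: int and q :: nat
  assumes "q > 0"
  shows "0 \<le> (\<Sum>k<q. cos (2 * pi * real_of_int m * (real k / real q)))"
proof -
  define z where "z = cis (2 * pi * real_of_int m / real q)"
  have "(\<Sum>k<q. cos (2 * pi * real_of_int m * (real k / real q))) = Re (\<Sum>k<q. z ^ k)"
    unfolding Re_sum z_def Complex.DeMoivre cis.sel by (simp add: mult_ac)
  also have "\<dots> \<ge> 0"
  proof (cases "z = 1")
    case False
    have "z ^ q = cis (2 * pi * real_of_int m)" using assms by (simp add: z_def Complex.DeMoivre)
    also have "\<dots> = 1" by (intro cis_multiple_2pi) simp
    finally show ?thesis using False by (simp add: sum_gp_strict)
  qed simp
  finally show ?thesis by simp
qed

text \<open>By linearity it suffices to transform a single cosine, and a product of two cosines is half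
  the sum of two cosines of integer frequency.\<close>

lemma discrete_cosine_transform_nonneg:
  assumes a: "nonneg_cosine_expansion f a" and "q > 0"
  shows "0 \<le> (\<Sum>k<q. f (real k / real q) * cos (2 * pi * real_of_int r * (real k / real q)))"
proof -
  define c where "c n = (\<Sum>k<q. cos (2 * pi * real n * (real k / real q))
                           * cos (2 * pi * real_of_int r * (real k / real q)))" for n
  have f: "(\<lambda>n. a n * cos (2 * pi * real n * x)) sums f x" for x
    using a by (simp add: nonneg_cosine_expansion_def)
  have "(\<lambda>n. \<Sum>k<q. a n * cos (2 * pi * real n * (real k / real q))
            * cos (2 * pi * real_of_int r * (real k / real q)))
        sums (\<Sum>k<q. f (real k / real q) * cos (2 * pi * real_of_int r * (real k / real q)))"
    by (intro sums_sum sums_mult2 f)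
  then have "(\<lambda>n. a n * c n)
        sums (\<Sum>k<q. f (real k / real q) * cos (2 * pi * real_of_int r * (real k / real q)))"
    by (simp add: c_def sum_distrib_left mult.assoc)
  moreover have "0 \<le> a n * c n" for n
  proof -
    have "2 * c n = (\<Sum>k<q. cos (2 * pi * real_of_int (int n - r) * (real k / real q)))
                    + (\<Sum>k<q. cos (2 * pi * real_of_int (int n + r) * (real k / real q)))"
      unfolding c_def sum_distrib_left sum.distrib[symmetric]
      by (intro sum.cong refl)
        (simp add: distrib_left right_diff_distrib distrib_right left_diff_distrib cos_add cos_diff
          diff_divide_distrib add_divide_distrib)
    then have "0 \<le> c n"
      using sum_cos_roots_of_unity_nonneg[OF \<open>q > 0\<close>, of "int n - r"]
        sum_cos_roots_of_unity_nonneg[OF \<open>q > 0\<close>, of "int n + r"] by linarith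
    then show ?thesis using a by (simp add: nonneg_cosine_expansion_def)
  qed
  ultimately show ?thesis by (rule sums_le[OF _ sums_zero, rotated]) 
qed

text \<open>The mean of the samples is the sum of \<open>a n\<close> over all multiples \<open>n\<close> of \<open>q\<close>; the
  estimate keeps only \<open>n = 0\<close>.\<close>

lemma constant_term_le_mean:
  assumes a: "nonneg_cosine_expansion f a" and "q > 0"
  shows "real q * a 0 \<le> (\<Sum>k<q. f (real k / real q))"
proof -
  define c where "c n = (\<Sum>k<q. cos (2 * pi * real n * (real k / real q)))" for n
  have f: "(\<lambda>n. a n * cos (2 * pi * real n * x)) sums f x" for x
    using a by (simp add: nonneg_cosine_expansion_def)
  have "(\<lambda>n. \<Sum>k<q. a n * cos (2 * pi * real n * (real k / real q)))
        sums (\<Sum>k<q. f (real k / real q))"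
    by (intro sums_sum f)
  then have sums: "(\<lambda>n. a n * c n) sums (\<Sum>k<q. f (real k / real q))"
    by (simp add: c_def sum_distrib_left)
  have "0 \<le> a n * c n" for n
    using a sum_cos_roots_of_unity_nonneg[OF \<open>q > 0\<close>, of "int n"]
    by (simp add: nonneg_cosine_expansion_def c_def)
  then have "(\<Sum>n\<in>{0}. a n * c n) \<le> (\<Sum>k<q. f (real k / real q))"
    using sums by (metis finite.emptyI finite.insertI sum_le_suminf sums_iff)
  then show ?thesis by (simp add: c_def mult.commute)
qed

text \<open>The weight \<open>g\<close> has the symmetries of the samples, so that the indices \<open>k\<close> and
  \<open>q - k\<close> contribute equally. The function vanishes at \<open>k/q\<close> for \<open>3 \<le> k \<le> q - 3\<close>,
  which leaves the five indices \<open>0\<close>, \<open>1\<close>, \<open>2\<close>, \<open>q - 2\<close>, \<open>q - 1\<close>.\<close>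

lemma K_class_sample_sum:
  fixes g :: "int \<Rightarrow> real"
  assumes f: "f \<in> K_class (3 / real q)" and q: "q \<ge> 6"
    and even: "\<And>k. g (- k) = g k" and period: "\<And>k. g (k + int q) = g k"
  shows "(\<Sum>k<q. f (real k / real q) * g (int k))
           = g 0 + 2 * f (1 / real q) * g 1 + 2 * f (2 / real q) * g 2"
proof -
  have f_per: "f (x + 1) = f x" and f_even: "f (- x) = f x" and f0: "f 0 = 1" for x
    using f by (auto simp: K_class_def)
  have f_zero: "f x = 0" if "3 / real q \<le> \<bar>x\<bar>" "\<bar>x\<bar> \<le> 1 / 2" for x
    using f that by (auto simp: K_class_def)
  define F where "F k = f (real k / real q) * g (int k)" for k
  have sym: "F (q - k) = F k" if "k \<le> q" for k
  proof -
    have "real (q - k) / real q = - (real k / real q) + 1"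
      using that q by (simp add: of_nat_diff field_simps)
    moreover have "int (q - k) = - int k + int q" using that by simp
    ultimately show ?thesis using f_per[of "- (real k / real q)"] f_even even[of "int k"]
        period[of "- int k"] by (simp only: F_def)
  qed
  have vanish: "F k = 0" if "3 \<le> k" "2 * k \<le> q" for k
    using that q by (auto simp: F_def field_simps intro!: f_zero)
  have "F k = 0" if "k \<in> {..<q} - {0, 1, 2, q - 2, q - 1}" for k
  proof (cases "2 * k \<le> q")
    case True
    then show ?thesis using that by (intro vanish) auto
  next
    case False
    then have "F (q - k) = 0" using that by (intro vanish) auto
    then show ?thesis using sym[of k] that by simp
  qed
  then have "(\<Sum>k<q. F k) = (\<Sum>k\<in>{0, 1, 2, q - 2, q - 1}. F k)"
    using q by (intro sum.mono_neutral_right) auto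
  also have "\<dots> = F 0 + F 1 + F 2 + F (q - 2) + F (q - 1)"
  proof -
    have "0 \<notin> {1, 2, q - 2, q - 1}" "1 \<notin> {2, q - 2, q - 1}" "2 \<notin> {q - 2, q - 1}" "q - 2 \<notin> {q - 1}"
      using q by auto
    then show ?thesis by (simp del: One_nat_def)
  qed
  also have "\<dots> = F 0 + 2 * F 1 + 2 * F 2" using sym[of 1] sym[of 2] q by simp
  finally show ?thesis by (simp add: F_def f0)
qed

text \<open>Linear programming duality with explicit multipliers. The weights
  \<open>\<alpha> / D\<close> and \<open>\<beta> / D\<close> solve \<open>\<alpha> c + \<beta> d = - D\<close> and
  \<open>\<alpha> (2 c\<^sup>2 - 1) + \<beta> (2 d\<^sup>2 - 1) = - D\<close>, so adding the weighted constraints to the objective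
  cancels \<open>u\<close> and \<open>v\<close>. They are nonnegative precisely because \<open>- 1/2\<close> separates \<open>c\<close> from
  \<open>d\<close>. When \<open>c\<close> and \<open>d\<close> are cosines, the hypotheses are the constraints
  \<open>P r \<ge> 0\<close> at two nodes, by the double angle formula.\<close>

lemma two_node_linear_programming_bound:
  fixes u v c d :: real
  assumes P: "0 \<le> 1 + 2 * u * c + 2 * v * (2 * c\<^sup>2 - 1)"
    and Q: "0 \<le> 1 + 2 * u * d + 2 * v * (2 * d\<^sup>2 - 1)"
    and c: "- 1 / 2 < c" "c \<le> 1" and d: "d < - 1 / 2" and cd: "0 < 1 + 2 * c * d"
  shows "1 + 2 * u + 2 * v \<le> 1 + (1 - 2 * (c + d)) / (1 + 2 * c * d)"
proof -
  define D where "D = (c - d) * (1 + 2 * c * d)"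
  define \<alpha> where "\<alpha> = (1 - d) * (- 1 - 2 * d)"
  define \<beta> where "\<beta> = (1 - c) * (1 + 2 * c)"
  have "0 < D" using c d cd by (simp add: D_def)
  have "0 \<le> \<alpha>" "0 \<le> \<beta>" using c d by (auto simp: \<alpha>_def \<beta>_def)
  then have "0 \<le> \<alpha> * (1 + 2 * u * c + 2 * v * (2 * c\<^sup>2 - 1))
                 + \<beta> * (1 + 2 * u * d + 2 * v * (2 * d\<^sup>2 - 1))"
    using P Q by (simp only: add_nonneg_nonneg mult_nonneg_nonneg)
  also have "\<dots> = \<alpha> + \<beta> - D * (2 * u + 2 * v)"
    unfolding \<alpha>_def \<beta>_def D_def power2_eq_square by algebra
  finally have "D * (2 * u + 2 * v) \<le> \<alpha> + \<beta>" by simp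
  also have "\<alpha> + \<beta> = (c - d) * (1 - 2 * (c + d))"
    unfolding \<alpha>_def \<beta>_def by algebra
  finally have "(2 * u + 2 * v) * (1 + 2 * c * d) \<le> 1 - 2 * (c + d)"
    using c d by (simp add: D_def mult.assoc mult.commute)
  then show ?thesis using cd by (simp add: pos_le_divide_eq)
qed

section \<open>The nodes adjacent to one third\<close>

text \<open>Subtracting from \<open>n\<close> the nearest multiple of \<open>q\<close> and taking the absolute value moves
  the angle into \<open>[0, \<pi>]\<close> without changing its cosine. There the cosine is decreasing, and the
  integer \<open>j\<close> so obtained is at most \<open>s\<close> or at least \<open>s + 1\<close>.\<close>

lemma cos_between_adjacent_nodes:
  fixes n s :: int and q :: nat
  assumes s: "0 \<le> s" "2 * (s + 1) \<le> int q"
  defines "\<theta> \<equiv> \<lambda>k. 2 * pi * real_of_int k / real q"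
  shows "0 \<le> (cos (\<theta> n) - cos (\<theta> s)) * (cos (\<theta> n) - cos (\<theta> (s + 1)))"
proof -
  have q: "real q > 0" using s by simp
  define k where "k = round (real_of_int n / real q)"
  define j where "j = \<bar>n - k * int q\<bar>"
  have "\<bar>real_of_int k - real_of_int n / real q\<bar> \<le> 1 / 2"
    unfolding k_def by (rule of_int_round_abs_le)
  then have "\<bar>real_of_int k - real_of_int n / real q\<bar> * real q \<le> real q / 2"
    using q by (simp add: mult_right_mono)
  also have "\<bar>real_of_int k - real_of_int n / real q\<bar> * real q = \<bar>real_of_int (n - k * int q)\<bar>"
  proof -
    have "(real_of_int k - real_of_int n / real q) * real q = - real_of_int (n - k * int q)"
      using q by (simp add: left_diff_distrib)
    then show ?thesis using q by (metis abs_minus_cancel abs_mult abs_of_pos)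
  qed
  finally have "real_of_int (2 * j) \<le> real_of_int (int q)" by (simp add: j_def)
  then have j: "0 \<le> j" "2 * j \<le> int q"
    unfolding of_int_le_iff by (simp_all add: j_def)
  have "\<theta> (n - k * int q) = \<theta> n - 2 * pi * real_of_int k"
    using q by (simp add: \<theta>_def field_simps)
  then have "cos (\<theta> (n - k * int q)) = cos (\<theta> n)"
    by (simp add: cos_diff)
  moreover have "cos (\<theta> j) = cos (\<theta> (n - k * int q))"
    by (simp add: j_def \<theta>_def abs_if minus_divide_left[symmetric])
       (metis cos_minus minus_diff_eq minus_divide_left mult_minus_right)
  ultimately have n_j: "cos (\<theta> n) = cos (\<theta> j)" by simp
  have mono: "cos (\<theta> l) \<le> cos (\<theta> i)" if "0 \<le> i" "i \<le> l" "2 * l \<le> int q" for i l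
  proof (rule cos_monotone_0_pi_le)
    show "0 \<le> \<theta> i" using that by (simp add: \<theta>_def)
    show "\<theta> i \<le> \<theta> l" using that by (simp add: \<theta>_def divide_right_mono)
    have "real_of_int (2 * l) \<le> real_of_int (int q)" using that by linarith
    then show "\<theta> l \<le> pi" using q by (simp add: \<theta>_def field_simps)
  qed
  show ?thesis
  proof (cases "j \<le> s")
    case True
    then show ?thesis unfolding n_j using s j mono[of j s] mono[of j "s + 1"]
      by (intro mult_nonneg_nonneg) auto
  next
    case False
    then show ?thesis unfolding n_j using s j mono[of s j] mono[of "s + 1" j]
      by (intro mult_nonpos_nonpos) auto
  qed
qed

text \<open>Besides the position relative to \<open>1/3\<close>, the bound \<open>1/4 \<le> r/q\<close> makes the first cosine
  nonpositive. This keeps the denominator \<open>1 + 2 cos (2 \<pi> r / q) cos (2 \<pi> (r + 1) / q)\<close> positive.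
  The bound holds from \<open>q = 7\<close> on and fails at \<open>q = 5\<close>, where \<open>r/q = 1/5\<close>.\<close>

lemma cos_nodes_around_third:
  fixes q :: nat and r :: int
  assumes "q \<ge> 7" and "\<not> 3 dvd q" and r: "r = \<lfloor>real q / 3\<rfloor>"
  shows "- 1 / 2 < cos (2 * pi * r / q)" "cos (2 * pi * r / q) \<le> 0"
    and "cos (2 * pi * (r + 1) / q) < - 1 / 2"
    and "0 \<le> r" "2 * (r + 1) \<le> int q"
proof -
  have r_div: "r = int (q div 3)" unfolding r using floor_divide_of_nat_eq[of q 3] by simp
  have bounds: "3 * r < int q" "int q < 3 * (r + 1)" "int q \<le> 4 * r" "2 * (r + 1) \<le> int q" "0 \<le> r"
    using assms(1,2) unfolding r_div by presburger+
  then show "0 \<le> r" "2 * (r + 1) \<le> int q" by auto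
  have reals: "real_of_int (3 * r) < real_of_int (int q)" "real_of_int (int q) < real_of_int (3 * (r + 1))"
    "real_of_int (int q) \<le> real_of_int (4 * r)" "real_of_int (2 * (r + 1)) \<le> real_of_int (int q)"
    unfolding of_int_less_iff of_int_le_iff by (fact bounds)+
  have q: "real q > 0" using assms by simp
  have cos_third: "cos (2 * pi / 3) = - 1 / 2" using cos_120 by simp
  have lt: "2 * pi * r / q < 2 * pi / 3" and ge: "pi / 2 \<le> 2 * pi * r / q"
    and gt: "2 * pi / 3 < 2 * pi * (r + 1) / q" and le: "2 * pi * (r + 1) / q \<le> pi"
    using reals q by (simp_all add: pos_divide_less_eq pos_less_divide_eq pos_divide_le_eq pos_le_divide_eq)
  show "- 1 / 2 < cos (2 * pi * r / q)"
    unfolding cos_third[symmetric] using lt ge pi_gt_zero by (intro cos_monotone_0_pi) auto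
  show "cos (2 * pi * r / q) \<le> 0"
    using cos_monotone_0_pi_le[of "pi / 2" "2 * pi * r / q"] lt ge pi_gt_zero by simp
  show "cos (2 * pi * (r + 1) / q) < - 1 / 2"
    unfolding cos_third[symmetric] using gt le by (intro cos_monotone_0_pi) auto
qed

section \<open>The extremal function\<close>

text \<open>A combination of five translates of the triangle function, with heights \<open>v\<close>, \<open>u\<close>,
  \<open>1\<close>, \<open>u\<close>, \<open>v\<close> at \<open>- 2/q\<close>, \<open>- 1/q\<close>, \<open>0\<close>, \<open>1/q\<close>, \<open>2/q\<close>. Adding the translates by \<open>k/q\<close> and
  \<open>- k/q\<close> multiplies the \<open>n\<close>-th coefficient by \<open>2 cos (2 \<pi> n k / q)\<close>, so the coefficients are nonnegative by
  hypothesis. The outermost translates end at \<open>\<plusminus> 3/q\<close>.\<close>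

lemma interpolant_of_positive_samples:
  fixes q :: nat and u v :: real
  assumes q: "q \<ge> 6"
    and pos: "\<And>n::nat. 0 \<le> 1 + 2 * u * cos (2 * pi * n / q) + 2 * v * cos (2 * pi * n * 2 / q)"
  obtains f a where "f \<in> K_class (3 / real q)" "nonneg_cosine_expansion f a"
    "a 0 = (1 + 2 * u + 2 * v) / real q"
proof -
  define w where "w = 1 / real q"
  define a where "a n = hat_coeff w n
      * (1 + 2 * u * cos (2 * pi * real n * w) + 2 * v * cos (2 * pi * real n * (2 * w)))" for n
  define f where "f x = hat w x + u * (hat w (x + w) + hat w (x - w))
      + v * (hat w (x + 2 * w) + hat w (x - 2 * w))" for x
  have w: "0 < w" "6 * w \<le> 1" using q by (auto simp: w_def)
  have sums: "(\<lambda>n. a n * cos (2 * pi * real n * x)) sums f x" for x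
  proof -
    let ?t = "\<lambda>x n. hat_coeff w n * cos (2 * pi * real n * x)"
    have "(\<lambda>n. ?t x n + u * (?t (x + w) n + ?t (x - w) n) + v * (?t (x + 2 * w) n + ?t (x - 2 * w) n))
            sums f x"
      unfolding f_def by (intro sums_add sums_mult hat_sums)
    moreover have "?t x n + u * (?t (x + w) n + ?t (x - w) n)
        + v * (?t (x + 2 * w) n + ?t (x - 2 * w) n) = a n * cos (2 * pi * real n * x)" for n
      by (simp add: a_def distrib_left[of "2 * pi * real n"] right_diff_distrib[of "2 * pi * real n"]
          cos_add cos_diff) (simp add: algebra_simps)
    ultimately show ?thesis by simp
  qed
  have "f 0 = 1"
    using w hat_eq_0[of w w] hat_eq_0[of w "2 * w"] by (simp add: f_def hat_0 hat_minus)
  then have "a sums 1" using sums[of 0] by simp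
  moreover have "0 \<le> a n" for n
    using pos[of n] w by (auto simp: a_def w_def mult_ac intro!: mult_nonneg_nonneg hat_coeff_nonneg)
  ultimately have exp: "nonneg_cosine_expansion f a"
    using sums by (simp add: nonneg_cosine_expansion_def)
  have "f x = 0" if "3 * w \<le> x" "x \<le> 1 / 2" for x
    using that w by (simp add: f_def hat_eq_0)
  then have "f \<in> K_class (3 / real q)"
    by (intro nonneg_cosine_expansion_in_K_class[OF exp]) (simp add: w_def)
  from this exp show thesis by (rule that) (simp add: a_def hat_coeff_def w_def)
qed

theorem theorem5:
  fixes q :: nat and r\<^sub>0 :: int
  assumes "q \<ge> 7" and "\<not> 3 dvd q" and "r\<^sub>0 = \<lfloor>real q / 3\<rfloor>"
  shows "A_sup (3 / real q) =
    1 / real q *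
      (1 + (1 - 2 * (cos (2 * pi * r\<^sub>0 / q) + cos (2 * pi * (r\<^sub>0 + 1) / q)))
           / (1 + 2 * cos (2 * pi * r\<^sub>0 / q) * cos (2 * pi * (r\<^sub>0 + 1) / q)))"
proof -
  define c where "c = cos (2 * pi * r\<^sub>0 / q)"
  define d where "d = cos (2 * pi * (r\<^sub>0 + 1) / q)"
  note nodes = cos_nodes_around_third[OF assms]
  have c: "- 1 / 2 < c" "c \<le> 0" and d: "d < - 1 / 2"
    using nodes(1-3) by (simp_all add: c_def d_def)
  have cd: "0 < 1 + 2 * c * d"
    using c d mult_nonpos_nonpos[of c d] by simp
  have cos_double_angle: "cos (2 * x) = 2 * (cos x)\<^sup>2 - 1" for x :: real
    by (simp add: cos_double_cos)
  have upper: "a 0 \<le> 1 / real q * (1 + (1 - 2 * (c + d)) / (1 + 2 * c * d))"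
    if f: "f \<in> K_class (3 / real q)" and a: "nonneg_cosine_expansion f a" for f a
  proof -
    define u where "u = f (1 / real q)"
    define v where "v = f (2 / real q)"
    have dct: "0 \<le> 1 + 2 * u * cos (2 * pi * r / q) + 2 * v * (2 * (cos (2 * pi * r / q))\<^sup>2 - 1)" for r :: int
    proof -
      let ?g = "\<lambda>k::int. cos (2 * pi * real_of_int r * (real_of_int k / real q))"
      have "?g (k + int q) = ?g k" for k
      proof -
        have "2 * pi * real_of_int r * (real_of_int (k + int q) / real q)
            = 2 * pi * real_of_int r * (real_of_int k / real q) + 2 * pi * real_of_int r"
          using assms(1) by (simp add: field_simps)
        then show ?thesis by (simp add: cos_add)
      qed
      then have "(\<Sum>k<q. f (real k / real q) * ?g (int k)) = ?g 0 + 2 * u * ?g 1 + 2 * v * ?g 2"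
        unfolding u_def v_def using assms(1) by (intro K_class_sample_sum[OF f]) auto
      moreover have "?g 2 = 2 * (?g 1)\<^sup>2 - 1"
        unfolding cos_double_angle[symmetric] by simp
      ultimately show ?thesis
        using discrete_cosine_transform_nonneg[OF a, of q r] assms(1) by simp
    qed
    have "real q * a 0 \<le> (\<Sum>k<q. f (real k / real q) * 1)"
      using constant_term_le_mean[OF a, of q] assms(1) by simp
    also have "\<dots> = 1 + 2 * u + 2 * v"
      using K_class_sample_sum[OF f, of "\<lambda>_. 1"] assms(1) by (simp add: u_def v_def)
    also have "\<dots> \<le> 1 + (1 - 2 * (c + d)) / (1 + 2 * c * d)"
      using dct[of r\<^sub>0] dct[of "r\<^sub>0 + 1"] c d cd
      by (intro two_node_linear_programming_bound) (auto simp: c_def d_def)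
    finally show ?thesis using assms(1) by (simp add: field_simps)
  qed
  obtain f a where fa: "f \<in> K_class (3 / real q)" "nonneg_cosine_expansion f a"
    and a0: "a 0 = 1 / real q * (1 + (1 - 2 * (c + d)) / (1 + 2 * c * d))"
  proof -
    define v where "v = 1 / (2 * (1 + 2 * c * d))"
    define u where "u = - 2 * v * (c + d)"
    \<comment> \<open>The choice for which \<open>1 + 2 u x + 2 v (2 x\<^sup>2 - 1)\<close> factors as \<open>4 v (x - c) (x - d)\<close>.\<close>
    have v: "0 \<le> v" "2 * v * (1 + 2 * c * d) = 1" using cd by (simp_all add: v_def)
    have "0 \<le> 1 + 2 * u * cos (2 * pi * n / q) + 2 * v * cos (2 * pi * n * 2 / q)" for n :: nat
    proof -
      define x where "x = cos (2 * pi * n / q)"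
      have "0 \<le> 4 * v * ((x - c) * (x - d))"
      proof (rule mult_nonneg_nonneg)
        show "0 \<le> (x - c) * (x - d)"
          using cos_between_adjacent_nodes[OF nodes(4,5), of "int n"] by (simp add: x_def c_def d_def)
      qed (use v(1) in simp)
      also have "\<dots> = 1 + 2 * u * x + 2 * v * (2 * x\<^sup>2 - 1)"
        using v(2) unfolding u_def power2_eq_square by algebra
      also have "2 * x\<^sup>2 - 1 = cos (2 * pi * n * 2 / q)"
        unfolding x_def cos_double_angle[symmetric] by (simp add: mult_ac)
      finally show ?thesis by (simp add: x_def)
    qed
    then obtain f a where fa: "f \<in> K_class (3 / real q)" "nonneg_cosine_expansion f a"
      and a0: "a 0 = (1 + 2 * u + 2 * v) / real q"
      using interpolant_of_positive_samples[of q u v] assms(1) by auto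
    have "(2 * u + 2 * v) * (1 + 2 * c * d) = 1 - 2 * (c + d)"
      using v(2) unfolding u_def by algebra
    then have "2 * u + 2 * v = (1 - 2 * (c + d)) / (1 + 2 * c * d)"
      using cd by (simp add: eq_divide_eq)
    with a0 have "a 0 = 1 / real q * (1 + (1 - 2 * (c + d)) / (1 + 2 * c * d))"
      by (simp only: add.assoc) simp
    with fa show thesis by (rule that)
  qed
  have "A_sup (3 / real q) = 1 / real q * (1 + (1 - 2 * (c + d)) / (1 + 2 * c * d))"
    unfolding A_sup_def
  proof (rule cSup_eq_maximum)
    show "1 / real q * (1 + (1 - 2 * (c + d)) / (1 + 2 * c * d))
        \<in> {a 0 |f a. f \<in> K_class (3 / real q) \<and> nonneg_cosine_expansion f a}"
      using fa a0[symmetric] by blast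
  qed (use upper in blast)
  then show ?thesis by (simp only: c_def d_def)
qed

end
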